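(* Let $(Q,\cdot)$ be a quasigroup and consider its six parastrophic operations $\cdot,\circ_1,\circ_2,\circ_3,\circ_4,\circ_5$. Then $(Q,\cdot)$ is medial if and only if any pair of its parastrophic binary operations satisfies the interchange law; more precisely, if $(Q,\cdot)$ is medial then for every (not necessarily distinct) pair $\ast,\star$ of these six operations, $(x\ast y)\star(z\ast w)=(x\star z)\ast(y\star w)$ for all $x,y,z,w\in Q$, and conversely if this holds for some such pair $\ast,\star$ then $(Q,\cdot)$ is medial.
   Context: A quasigroup is a magma $(Q,\cdot)$ in which for all $a,b$ the equations $ax=b$, $ya=b$ have unique solutions. It is medial if $(xy)(zw)=(xz)(yw)$ for all $x,y,z,w$. The parastrophes of $(Q,\cdot)$ are the operations defined by: $x\circ_1 y=z\iff xz=y$; $x\circ_2 y=z\iff zy=x$; $x\circ_3 y=z\iff zx=y$; $x\circ_4 y=z\iff yz=x$; $x\circ_5 y=z\iff yx=z$. *)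

theory Defs
  imports Main
begin

definition quasigroup :: "('a \<Rightarrow> 'a \<Rightarrow> 'a) \<Rightarrow> bool" where
  "quasigroup f \<longleftrightarrow> (\<forall>a b. (\<exists>!x. f a x = b) \<and> (\<exists>!y. f y a = b))"

definition medial :: "('a \<Rightarrow> 'a \<Rightarrow> 'a) \<Rightarrow> bool" where
  "medial f \<longleftrightarrow> (\<forall>x y z w. f (f x y) (f z w) = f (f x z) (f y w))"

definition para1 :: "('a \<Rightarrow> 'a \<Rightarrow> 'a) \<Rightarrow> 'a \<Rightarrow> 'a \<Rightarrow> 'a" where
  "para1 f x y = (THE z. f x z = y)"
definition para2 :: "('a \<Rightarrow> 'a \<Rightarrow> 'a) \<Rightarrow> 'a \<Rightarrow> 'a \<Rightarrow> 'a" where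
  "para2 f x y = (THE z. f z y = x)"
definition para3 :: "('a \<Rightarrow> 'a \<Rightarrow> 'a) \<Rightarrow> 'a \<Rightarrow> 'a \<Rightarrow> 'a" where
  "para3 f x y = (THE z. f z x = y)"
definition para4 :: "('a \<Rightarrow> 'a \<Rightarrow> 'a) \<Rightarrow> 'a \<Rightarrow> 'a \<Rightarrow> 'a" where
  "para4 f x y = (THE z. f y z = x)"
definition para5 :: "('a \<Rightarrow> 'a \<Rightarrow> 'a) \<Rightarrow> 'a \<Rightarrow> 'a \<Rightarrow> 'a" where
  "para5 f x y = f y x"

definition parastrophes :: "('a \<Rightarrow> 'a \<Rightarrow> 'a) \<Rightarrow> ('a \<Rightarrow> 'a \<Rightarrow> 'a) set" where
  "parastrophes f = {f, para1 f, para2 f, para3 f, para4 f, para5 f}"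

definition interchange :: "('a \<Rightarrow> 'a \<Rightarrow> 'a) \<Rightarrow> ('a \<Rightarrow> 'a \<Rightarrow> 'a) \<Rightarrow> bool" where
  "interchange g h \<longleftrightarrow> (\<forall>x y z w. h (g x y) (g z w) = g (h x z) (h y w))"

end

theory Submission
  imports Defs
begin

text \<open>
  The interchange law for \<open>g\<close> and \<open>h\<close> says that the graph of \<open>h\<close>, as a ternary relation, is closed
  under \<open>g\<close> applied componentwise. Passing to a parastrophe of \<open>h\<close> only permutes the three coordinates
  of the graph, so it does not affect the law; since the law is symmetric in \<open>g\<close> and \<open>h\<close>, the same
  holds for \<open>g\<close>. Hence all pairs of parastrophes of \<open>f\<close> satisfy the law exactly when \<open>f\<close> and \<open>f\<close>
  do, which is mediality.
\<close>

text \<open>Unique solvability makes each \<open>THE\<close> the actual solution, so every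
  parastrophe has the graph of \<open>f\<close> with coordinates permuted.\<close>

lemma parastrophe_graph_iff:
  assumes "quasigroup f"
  shows "para1 f x y = z \<longleftrightarrow> f x z = y"
    and "para2 f x y = z \<longleftrightarrow> f z y = x"
    and "para3 f x y = z \<longleftrightarrow> f z x = y"
    and "para4 f x y = z \<longleftrightarrow> f y z = x"
    and "para5 f x y = z \<longleftrightarrow> f y x = z"
proof -
  have ex1_left: "\<exists>!z. f a z = b" and ex1_right: "\<exists>!z. f z a = b" for a b
    using assms unfolding quasigroup_def by auto
  have THE_iff: "(THE z. P z) = z \<longleftrightarrow> P z" if "\<exists>!z. P z" for P :: "'a \<Rightarrow> bool" and z
    using theI'[OF that] the1_equality[OF that] by blast
  show "para1 f x y = z \<longleftrightarrow> f x z = y" "para4 f x y = z \<longleftrightarrow> f y z = x"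
    unfolding para1_def para4_def by (rule THE_iff[OF ex1_left])+
  show "para2 f x y = z \<longleftrightarrow> f z y = x" "para3 f x y = z \<longleftrightarrow> f z x = y"
    unfolding para2_def para3_def by (rule THE_iff[OF ex1_right])+
  show "para5 f x y = z \<longleftrightarrow> f y x = z"
    unfolding para5_def ..
qed

text \<open>Naming the values \<open>z\<close> and \<open>z'\<close> leaves \<open>h\<close> only in
  graph equations, where a permuted graph can be substituted.\<close>

lemma interchange_iff_graph_closed:
  "interchange g h \<longleftrightarrow>
    (\<forall>x y z x' y' z'. h x y = z \<longrightarrow> h x' y' = z' \<longrightarrow> h (g x x') (g y y') = g z z')"
  unfolding interchange_def by metis

lemma interchange_commute: "interchange g h \<longleftrightarrow> interchange h g"
  unfolding interchange_def by metis

lemma medial_iff_interchange: "medial f \<longleftrightarrow> interchange f f"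
  unfolding medial_def interchange_def ..

lemma interchange_parastrophe_iff:
  assumes "quasigroup f" and "h \<in> parastrophes f"
  shows "interchange g h \<longleftrightarrow> interchange g f"
  \<comment> \<open>Once \<open>h\<close> is rewritten to \<open>f\<close>, both sides agree up to
    renaming and reordering of the quantified variables.\<close>
  using assms(2) unfolding parastrophes_def interchange_iff_graph_closed
  by (elim insertE emptyE) (simp_all only: parastrophe_graph_iff[OF assms(1)], blast+)

theorem theorem7p1:
  fixes f :: "'a \<Rightarrow> 'a \<Rightarrow> 'a"
  assumes "quasigroup f"
  shows "(medial f \<longrightarrow> (\<forall>g\<in>parastrophes f. \<forall>h\<in>parastrophes f. interchange g h))
       \<and> ((\<exists>g\<in>parastrophes f. \<exists>h\<in>parastrophes f. interchange g h) \<longrightarrow> medial f)"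
proof -
  have "interchange g h \<longleftrightarrow> medial f" if "g \<in> parastrophes f" "h \<in> parastrophes f" for g h
  proof -
    have "interchange g h \<longleftrightarrow> interchange g f"
      using assms that(2) by (rule interchange_parastrophe_iff)
    \<comment> \<open>The swap brings \<open>g\<close> into the second slot, where parastrophes can
      be replaced by \<open>f\<close>.\<close>
    also have "\<dots> \<longleftrightarrow> interchange f g"
      by (rule interchange_commute)
    also have "\<dots> \<longleftrightarrow> interchange f f"
      using assms that(1) by (rule interchange_parastrophe_iff)
    also have "\<dots> \<longleftrightarrow> medial f"
      by (simp only: medial_iff_interchange)
    finally show ?thesis .
  qed
  then show ?thesis by blast
qed

end
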